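(* Let $X$ be a first countable topological space in which every closed subset is separable, and let $x=(x_n)_{n\ge 1}$ be a sequence taking values in $X$. Then the set of subsequences which preserve the ordinary limit points of $x$, i.e. the set $$\{\omega\in(0,1]: \mathrm{L}_{x\upharpoonright\omega}=\mathrm{L}_x\},$$ is comeager.
   Context: $\mathbf{N}$ is the set of positive integers. $\mathrm{L}_x$ is the set of ordinary limit points of a sequence $x$ in $X$: all $\ell\in X$ such that some subsequence of $x$ converges to $\ell$. For $\omega\in(0,1]$ let $\sum_{i\ge1}d_i(\omega)2^{-i}$ be its unique non-terminating dyadic expansion, $d_i(\omega)\in\{0,1\}$ (infinitely many digits equal to $1$). If $n_1<n_2<\cdots$ enumerates $\{i: d_i(\omega)=1\}$, then $x\upharpoonright\omega$ denotes the subsequence $(x_{n_k})_{k\ge1}$, regarded as a sequence indexed by $k\in\mathbf{N}$. This identifies subsequences of $x$ with points of $(0,1]$. Comeager means having meager (first category) complement in $(0,1]$ with its usual topology. *)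

theory Defs
  imports "HOL-Analysis.Analysis"
begin

text \<open>Sequences \<open>(x\<^sub>n)\<^sub>n\<^sub>\<ge>\<^sub>1\<close> are rendered as functions on \<^typ>\<open>nat\<close> whose value at \<open>0\<close> is
  irrelevant.\<close>

subsection \<open>Baire category\<close>

definition nowhere_dense_in :: "'a topology \<Rightarrow> 'a set \<Rightarrow> bool" where
  "nowhere_dense_in T A \<longleftrightarrow> A \<subseteq> topspace T \<and> T interior_of (T closure_of A) = {}"

definition meager_in :: "'a topology \<Rightarrow> 'a set \<Rightarrow> bool" where
  "meager_in T A \<longleftrightarrow> (\<exists>\<A>. countable \<A> \<and> (\<forall>B\<in>\<A>. nowhere_dense_in T B) \<and> A = \<Union>\<A>)"

definition comeager_in :: "'a topology \<Rightarrow> 'a set \<Rightarrow> bool" where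
  "comeager_in T A \<longleftrightarrow> A \<subseteq> topspace T \<and> meager_in T (topspace T - A)"

subsection \<open>Ordinary limit points\<close>

text \<open>The indices are restricted to \<open>{1..}\<close> so that \<open>x 0\<close> is never used.\<close>

definition limit_points :: "'a topology \<Rightarrow> (nat \<Rightarrow> 'a) \<Rightarrow> 'a set" where
  "limit_points X x =
     {l \<in> topspace X. \<exists>\<sigma>. strict_mono_on {1..} \<sigma> \<and> \<sigma> ` {1..} \<subseteq> {1..} \<and>
        limitin X (\<lambda>k. x (\<sigma> k)) l sequentially}"

subsection \<open>Subsequences as points of \<open>(0,1]\<close>\<close>

text \<open>Digits are indexed from \<open>1\<close>; the requirement \<open>d 0 = 0\<close> only fixes the unused value at \<open>0\<close>, so that
  \<open>d\<close> is unique as a function on \<^typ>\<open>nat\<close>.\<close>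

definition nonterminating_dyadic_expansion :: "real \<Rightarrow> (nat \<Rightarrow> nat) \<Rightarrow> bool" where
  "nonterminating_dyadic_expansion \<omega> d \<longleftrightarrow>
     d 0 = 0 \<and> (\<forall>i\<ge>1. d i \<in> {0, 1}) \<and> infinite {i. i \<ge> 1 \<and> d i = 1} \<and>
     (\<lambda>i. real (d (Suc i)) / 2 ^ Suc i) sums \<omega>"

definition dyadic_digit :: "real \<Rightarrow> nat \<Rightarrow> nat" where
  "dyadic_digit \<omega> = (THE d. nonterminating_dyadic_expansion \<omega> d)"

text \<open>\<^const>\<open>enumerate\<close> counts from \<open>0\<close>, so the \<open>k\<close>-th element of the set (\<open>k \<ge> 1\<close>) has
  number \<open>k - 1\<close>.\<close>

definition subseq_at :: "(nat \<Rightarrow> 'a) \<Rightarrow> real \<Rightarrow> nat \<Rightarrow> 'a" (infixl "\<restriction>\<^sub>d" 100) where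
  "x \<restriction>\<^sub>d \<omega> = (\<lambda>k. x (enumerate {i. i \<ge> 1 \<and> dyadic_digit \<omega> i = 1} (k - 1)))"

text \<open>The description in \<^const>\<open>dyadic_digit\<close> is proper on \<open>(0,1]\<close>.\<close>

lemma nonterminating_dyadic_partial_sum:
  assumes "nonterminating_dyadic_expansion \<omega> d"
  shows "(\<Sum>i<n. real (d (Suc i)) / 2 ^ Suc i) = real_of_int (\<lceil>2 ^ n * \<omega>\<rceil> - 1) / 2 ^ n"
proof -
  define f where "f = (\<lambda>i. real (d (Suc i)) / 2 ^ Suc i)"
  have f: "f sums \<omega>" and d01: "\<And>i. d (Suc i) \<in> {0, 1}"
    and inf: "infinite {i. i \<ge> 1 \<and> d i = 1}"
    using assms unfolding nonterminating_dyadic_expansion_def f_def by auto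
  have smf: "summable f" and om: "suminf f = \<omega>"
    using f by (auto simp: sums_iff)
  have tail: "\<omega> = (\<Sum>i. f (i + n)) + sum f {..<n}"
    using suminf_split_initial_segment[OF smf, of n] om by simp
  have sm: "summable (\<lambda>i. f (i + n))"
    using smf by (simp add: summable_iff_shift)
  have pos: "(\<Sum>i. f (i + n)) > 0"
  proof -
    obtain m where m: "m > n" "d m = 1"
      using inf unfolding infinite_nat_iff_unbounded by blast
    have "0 < f ((m - Suc n) + n)"
      using m by (simp add: f_def)
    then show ?thesis
      using sm by (intro suminf_pos2) (auto simp: f_def)
  qed
  have geo: "(\<lambda>i. (1/2::real) ^ i * (1 / 2 ^ Suc n)) sums (1 / (1 - 1/2) * (1 / 2 ^ Suc n))"
    by (intro sums_mult2 geometric_sums) auto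
  have le: "f (i + n) \<le> (1/2) ^ i * (1 / 2 ^ Suc n)" for i
    using d01[of "i + n"] by (auto simp: f_def field_simps power_add)
  have up: "(\<Sum>i. f (i + n)) \<le> 1 / 2 ^ n"
    using suminf_le[OF le sm sums_summable[OF geo]] sums_unique[OF geo] by simp
  have "\<exists>z::int. 2 ^ n * sum f {..<n} = of_int z"
  proof (induction n)
    case (Suc n)
    then obtain z :: int where "2 ^ n * sum f {..<n} = of_int z" by blast
    then have "2 ^ Suc n * sum f {..<Suc n} = of_int (2 * z + int (d (Suc n)))"
      by (simp add: f_def field_simps)
    then show ?case by blast
  qed auto
  then obtain z :: int where z: "2 ^ n * sum f {..<n} = of_int z" by blast
  have "of_int z < 2 ^ n * \<omega>" "2 ^ n * \<omega> \<le> of_int z + 1"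
    using pos up unfolding tail z[symmetric] by (auto simp: field_simps)
  then have "\<lceil>2 ^ n * \<omega>\<rceil> = z + 1"
    by (intro ceiling_unique) auto
  then have "sum f {..<n} = real_of_int (\<lceil>2 ^ n * \<omega>\<rceil> - 1) / 2 ^ n"
    using z by (simp add: field_simps)
  then show ?thesis
    unfolding f_def .
qed

lemma nonterminating_dyadic_unique:
  assumes "nonterminating_dyadic_expansion \<omega> d" "nonterminating_dyadic_expansion \<omega> e"
  shows "d = e"
proof
  fix i
  show "d i = e i"
  proof (cases i)
    case 0
    then show ?thesis using assms by (simp add: nonterminating_dyadic_expansion_def)
  next
    case (Suc n)
    have "(\<Sum>i<k. real (d (Suc i)) / 2 ^ Suc i) = (\<Sum>i<k. real (e (Suc i)) / 2 ^ Suc i)" for k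
      using nonterminating_dyadic_partial_sum[OF assms(1), of k]
        nonterminating_dyadic_partial_sum[OF assms(2), of k] by simp
    from this[of n] this[of "Suc n"] show ?thesis
      using Suc by simp
  qed
qed

lemma nonterminating_dyadic_exists:
  assumes "\<omega> \<in> {0<..1}"
  shows "\<exists>d. nonterminating_dyadic_expansion \<omega> d"
proof -
  define c where "c = (\<lambda>n. \<lceil>2 ^ n * \<omega>\<rceil> - 1)"
  define d where "d = (\<lambda>n. if n = 0 then 0 else nat (c n mod 2))"
  define f where "f = (\<lambda>i. real (d (Suc i)) / 2 ^ Suc i)"
  have c0: "c 0 = 0"
    using assms by (auto simp: c_def ceiling_eq_iff)
  have cb: "of_int (c n) < 2 ^ n * \<omega>" "2 ^ n * \<omega> \<le> of_int (c n) + 1" for n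
    unfolding c_def by linarith+
  have cS: "c (Suc n) = 2 * c n + int (d (Suc n))" for n
  proof -
    have "real_of_int (c (Suc n)) < real_of_int (2 * c n + 2)"
      "real_of_int (2 * c n) < real_of_int (c (Suc n) + 1)"
      using cb[of n] cb[of "Suc n"] by simp_all
    then have "c (Suc n) < 2 * c n + 2" "2 * c n < c (Suc n) + 1"
      unfolding of_int_less_iff by auto
    then have "c (Suc n) = 2 * c n \<or> c (Suc n) = 2 * c n + 1"
      by linarith
    then show ?thesis
      by (auto simp: d_def)
  qed
  have S: "sum f {..<n} = of_int (c n) / 2 ^ n" for n
    by (induction n) (auto simp: c0 cS f_def field_simps)
  have "f sums \<omega>"
    unfolding sums_def
  proof (rule tendsto_sandwich)
    show "\<forall>\<^sub>F n in sequentially. \<omega> - (1/2) ^ n \<le> sum f {..<n}"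
    proof (intro always_eventually allI)
      fix n
      have "\<omega> \<le> (of_int (c n) + 1) / 2 ^ n"
        using cb(2)[of n] by (simp add: pos_le_divide_eq mult.commute)
      then show "\<omega> - (1/2) ^ n \<le> sum f {..<n}"
        by (simp add: S add_divide_distrib power_one_over)
    qed
    show "\<forall>\<^sub>F n in sequentially. sum f {..<n} \<le> \<omega>"
      using cb(1)[THEN less_imp_le] by (intro always_eventually) (auto simp: S field_simps)
    have "(\<lambda>n. \<omega> - (1/2) ^ n) \<longlonglongrightarrow> \<omega> - 0"
      by (intro tendsto_diff tendsto_const LIMSEQ_power_zero) auto
    then show "(\<lambda>n. \<omega> - (1/2) ^ n) \<longlonglongrightarrow> \<omega>" by simp
  qed simp
  moreover have d01: "d i \<in> {0, 1}" for i
    unfolding d_def by (auto simp: nat_eq_iff)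
  moreover have "infinite {i. i \<ge> 1 \<and> d i = 1}"
  proof
    assume "finite {i. i \<ge> 1 \<and> d i = 1}"
    then obtain N where N: "\<And>i. i \<ge> 1 \<Longrightarrow> d i = 1 \<Longrightarrow> i \<le> N"
      unfolding finite_nat_set_iff_bounded_le by blast
    have "f i = 0" if "i \<notin> {..<N}" for i
      using N[of "Suc i"] d01[of "Suc i"] that by (auto simp: f_def)
    then have "f sums sum f {..<N}"
      by (intro sums_finite) auto
    then have "\<omega> = sum f {..<N}"
      using \<open>f sums \<omega>\<close> sums_unique2 by blast
    then show False
      using cb(1)[of N] by (simp add: S field_simps)
  qed
  ultimately have "nonterminating_dyadic_expansion \<omega> d"
    unfolding nonterminating_dyadic_expansion_def f_def by (auto simp: d_def)
  then show ?thesis by blast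
qed

lemma nonterminating_dyadic_expansion_dyadic_digit:
  assumes "\<omega> \<in> {0<..1}"
  shows "nonterminating_dyadic_expansion \<omega> (dyadic_digit \<omega>)"
  unfolding dyadic_digit_def
  using nonterminating_dyadic_exists[OF assms] nonterminating_dyadic_unique by (metis theI)

end

theory Submission
  imports Defs
begin

text \<open>
  In a first countable space the limit points of a sequence are exactly its cluster points, the
  points all of whose neighbourhoods are visited infinitely often
  (\<open>limit_points_eq_cluster\<close>). Cluster points of a subsequence are cluster points of the
  sequence, so only \<open>L\<^sub>x \<subseteq> L\<^sub>x\<^sub>\<restriction>\<^sub>\<omega>\<close> is at stake; and since a set of cluster points is closed,
  this inclusion holds as soon as \<open>L\<^sub>x\<^sub>\<restriction>\<^sub>\<omega>\<close> contains a countable dense subset \<open>D\<close> of \<open>L\<^sub>x\<close>.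
  Such a \<open>D\<close> exists because \<open>L\<^sub>x\<close> is closed, hence separable.

  Every point of \<open>D\<close> has a countable neighbourhood base, so the failure of \<open>D \<subseteq> L\<^sub>x\<^sub>\<restriction>\<^sub>\<omega>\<close> is a
  countable union of conditions of the following form: \<open>\<omega>\<close> selects no index beyond \<open>N\<close> from
  \<open>{n. x\<^sub>n \<in> V}\<close>, where that index set is infinite. Each such condition is nowhere dense
  (\<open>nowhere_dense_avoiding\<close>): inside any interval one may fix one late digit, at an index of the
  infinite set, to be \<open>1\<close> without leaving the interval.
\<close>

section \<open>Limit points and cluster points\<close>

text \<open>The finite intersections of initial members of a countable base at \<open>l\<close> form a decreasing base.
  If all neighbourhoods of \<open>l\<close> are visited infinitely often, visits to the members of this base can be
  chosen one after the other at increasing times, and they converge to \<open>l\<close>.\<close>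

lemma limit_points_eq_cluster:
  assumes "first_countable X"
  shows "limit_points X y =
    {l \<in> topspace X. \<forall>U. openin X U \<longrightarrow> l \<in> U \<longrightarrow> infinite {n. 1 \<le> n \<and> y n \<in> U}}"
proof (intro set_eqI iffI)
  fix l
  assume "l \<in> limit_points X y"
  then obtain \<sigma> where l: "l \<in> topspace X" and mono: "strict_mono_on {1..} \<sigma>"
    and ran: "\<sigma> ` {1..} \<subseteq> {1..}" and lim: "limitin X (\<lambda>k. y (\<sigma> k)) l sequentially"
    unfolding limit_points_def by blast
  have "infinite {n. 1 \<le> n \<and> y n \<in> U}" if U: "openin X U" "l \<in> U" for U
  proof -
    obtain K where K: "\<And>k. k \<ge> K \<Longrightarrow> y (\<sigma> k) \<in> U"
      using lim U unfolding limitin_def eventually_sequentially by blast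
    have "inj_on \<sigma> {max 1 K..}"
      by (rule inj_on_subset[OF strict_mono_on_imp_inj_on[OF mono]]) auto
    then have "infinite (\<sigma> ` {max 1 K..})"
      using finite_imageD infinite_Ici by blast
    moreover have "\<sigma> ` {max 1 K..} \<subseteq> {n. 1 \<le> n \<and> y n \<in> U}"
      using K ran by (auto simp: image_subset_iff)
    ultimately show ?thesis
      using finite_subset by blast
  qed
  with l show "l \<in> {l \<in> topspace X. \<forall>U. openin X U \<longrightarrow> l \<in> U \<longrightarrow> infinite {n. 1 \<le> n \<and> y n \<in> U}}"
    by blast
next
  fix l
  assume "l \<in> {l \<in> topspace X. \<forall>U. openin X U \<longrightarrow> l \<in> U \<longrightarrow> infinite {n. 1 \<le> n \<and> y n \<in> U}}"
  then have l: "l \<in> topspace X"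
    and inf: "\<And>U. openin X U \<Longrightarrow> l \<in> U \<Longrightarrow> infinite {n. 1 \<le> n \<and> y n \<in> U}" by auto
  obtain \<B> where cB: "countable \<B>" and oB: "\<And>V. V \<in> \<B> \<Longrightarrow> openin X V"
    and bB: "\<And>U. openin X U \<Longrightarrow> l \<in> U \<Longrightarrow> \<exists>V\<in>\<B>. l \<in> V \<and> V \<subseteq> U"
    using assms l unfolding first_countable_def by metis
  define \<C> where "\<C> = {V \<in> \<B>. l \<in> V}"
  have cC: "countable \<C>" using cB by (simp add: \<C>_def)
  have neC: "\<C> \<noteq> {}" using bB[OF openin_topspace l] by (auto simp: \<C>_def)
  define W where "W k = (\<Inter>i\<le>k. from_nat_into \<C> i)" for k :: nat
  have inC: "from_nat_into \<C> i \<in> \<C>" for i by (rule from_nat_into[OF neC])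
  have oW: "openin X (W k)" for k
    unfolding W_def using inC oB by (intro openin_Inter) (auto simp: \<C>_def)
  have lW: "l \<in> W k" for k
    unfolding W_def using inC by (auto simp: \<C>_def)
  have visit: "\<exists>n. N < n \<and> y n \<in> W k" for N k
    using inf[OF oW lW, of k] unfolding infinite_nat_iff_unbounded by blast
  have "\<exists>\<sigma>. \<forall>k. (1 \<le> \<sigma> k \<and> y (\<sigma> k) \<in> W k) \<and> \<sigma> k < \<sigma> (Suc k)"
  proof (rule dependent_nat_choice)
    show "\<exists>n. 1 \<le> n \<and> y n \<in> W 0"
      using visit[of 0 0] by (auto intro: Suc_leI)
    show "\<exists>m. (1 \<le> m \<and> y m \<in> W (Suc k)) \<and> n < m" if "1 \<le> n \<and> y n \<in> W k" for n k
      using visit[of n "Suc k"] that by (meson less_imp_le order_trans)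
  qed
  then obtain \<sigma> where s1: "\<And>k. 1 \<le> \<sigma> k" and sW: "\<And>k. y (\<sigma> k) \<in> W k"
    and sS: "\<And>k. \<sigma> k < \<sigma> (Suc k)" by blast
  have "strict_mono \<sigma>" using sS by (simp add: strict_mono_Suc_iff)
  then have "strict_mono_on {1..} \<sigma>"
    by (simp add: strict_mono_def strict_mono_on_def)
  moreover have "\<sigma> ` {1..} \<subseteq> {1..}" using s1 by auto
  moreover have "limitin X (\<lambda>k. y (\<sigma> k)) l sequentially"
    unfolding limitin_def eventually_sequentially
  proof (intro conjI l allI impI)
    fix U assume "openin X U \<and> l \<in> U"
    then obtain V where V: "V \<in> \<C>" "V \<subseteq> U" using bB unfolding \<C>_def by blast
    then obtain i where "from_nat_into \<C> i = V"
      using from_nat_into_surj[OF cC] by blast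
    then have "W k \<subseteq> U" if "k \<ge> i" for k
      using that V unfolding W_def by blast
    then show "\<exists>K. \<forall>k\<ge>K. y (\<sigma> k) \<in> U" using sW by blast
  qed
  ultimately show "l \<in> limit_points X y"
    using l unfolding limit_points_def by blast
qed

lemma closedin_limit_points:
  assumes "first_countable X"
  shows "closedin X (limit_points X y)"
proof -
  have "limit_points X y \<subseteq> topspace X" by (auto simp: limit_points_def)
  moreover have "X closure_of limit_points X y \<subseteq> limit_points X y"
  proof
    fix l assume l: "l \<in> X closure_of limit_points X y"
    have "infinite {n. 1 \<le> n \<and> y n \<in> U}" if U: "openin X U" "l \<in> U" for U
    proof -
      obtain l' where "l' \<in> limit_points X y" "l' \<in> U"
        using l U unfolding in_closure_of by blast
      with U show ?thesis unfolding limit_points_eq_cluster[OF assms] by blast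
    qed
    then show "l \<in> limit_points X y"
      using l unfolding limit_points_eq_cluster[OF assms] in_closure_of by blast
  qed
  ultimately show ?thesis using closure_of_subset_eq by metis
qed

lemma infinite_dyadic_digit_ones:
  assumes "\<omega> \<in> {0<..1}"
  shows "infinite {i. i \<ge> 1 \<and> dyadic_digit \<omega> i = 1}"
  using nonterminating_dyadic_expansion_dyadic_digit[OF assms]
  unfolding nonterminating_dyadic_expansion_def by blast

text \<open>Reindexing along the increasing enumeration of the selected indices turns visits of the
  subsequence into selected visits of the sequence.\<close>

lemma infinite_visits_subseq_at_iff:
  assumes "\<omega> \<in> {0<..1}"
  shows "infinite {k. 1 \<le> k \<and> (x \<restriction>\<^sub>d \<omega>) k \<in> U} \<longleftrightarrow>
    infinite {n. 1 \<le> n \<and> dyadic_digit \<omega> n = 1 \<and> x n \<in> U}"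
proof -
  define S where "S = {i. i \<ge> 1 \<and> dyadic_digit \<omega> i = 1}"
  have S: "infinite S" unfolding S_def by (rule infinite_dyadic_digit_ones[OF assms])
  define f where "f k = enumerate S (k - 1)" for k
  have inj: "inj_on f {1..}"
  proof (rule inj_onI)
    fix k l assume kl: "k \<in> {1..}" "l \<in> {1..}" "f k = f l"
    then have "k - 1 = l - 1"
      using strict_mono_eq[OF strict_mono_enumerate[OF S]] unfolding f_def by blast
    with kl show "k = l" by auto
  qed
  have sub: "(x \<restriction>\<^sub>d \<omega>) k = x (f k)" for k
    unfolding subseq_at_def f_def S_def ..
  have img: "f ` {k. 1 \<le> k \<and> (x \<restriction>\<^sub>d \<omega>) k \<in> U} = {n \<in> S. x n \<in> U}"
  proof (intro set_eqI iffI)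
    fix n assume "n \<in> f ` {k. 1 \<le> k \<and> (x \<restriction>\<^sub>d \<omega>) k \<in> U}"
    then show "n \<in> {n \<in> S. x n \<in> U}"
      using enumerate_in_set[OF S] by (auto simp: sub f_def)
  next
    fix n assume n: "n \<in> {n \<in> S. x n \<in> U}"
    then obtain j where "enumerate S j = n" using enumerate_Ex[of S n] S by blast
    with n show "n \<in> f ` {k. 1 \<le> k \<and> (x \<restriction>\<^sub>d \<omega>) k \<in> U}"
      by (intro image_eqI[of _ _ "Suc j"]) (auto simp: sub f_def)
  qed
  have inj': "inj_on f {k. 1 \<le> k \<and> (x \<restriction>\<^sub>d \<omega>) k \<in> U}"
    by (rule inj_on_subset[OF inj]) auto
  have "finite {k. 1 \<le> k \<and> (x \<restriction>\<^sub>d \<omega>) k \<in> U} \<longleftrightarrow> finite {n \<in> S. x n \<in> U}"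
    using finite_image_iff[OF inj'] unfolding img by (rule sym)
  moreover have "{n \<in> S. x n \<in> U} = {n. 1 \<le> n \<and> dyadic_digit \<omega> n = 1 \<and> x n \<in> U}"
    unfolding S_def by blast
  ultimately show ?thesis by simp
qed

section \<open>Sets of subsequences avoiding an infinite set of indices\<close>

text \<open>The \<open>m\<close>-th digit is the difference of two consecutive partial sums, which are given by
  the ceilings of \<open>2 ^ (m - 1) * \<omega>\<close> and \<open>2 ^ m * \<omega>\<close>; here these are \<open>k / 2\<close> and \<open>k\<close>.\<close>

lemma dyadic_digit_eq_1:
  assumes "\<omega> \<in> {0<..1}" "even k" and m: "1 \<le> m"
    and w: "real_of_int (k - 1) / 2 ^ m < \<omega>" "\<omega> < real_of_int k / 2 ^ m"
  shows "dyadic_digit \<omega> m = 1"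
proof -
  obtain n where n: "m = Suc n" using m by (cases m) auto
  obtain j where j: "k = 2 * j" using \<open>even k\<close> by blast
  define d where "d = dyadic_digit \<omega>"
  define f where "f = (\<lambda>i. real (d (Suc i)) / 2 ^ Suc i)"
  note P = nonterminating_dyadic_partial_sum
      [OF nonterminating_dyadic_expansion_dyadic_digit[OF assms(1)], folded d_def, folded f_def]
  have w': "real_of_int k - 1 < 2 ^ m * \<omega>" "2 ^ m * \<omega> < real_of_int k"
    using w by (auto simp: field_simps)
  have c1: "\<lceil>2 ^ m * \<omega>\<rceil> = k" using w' by (intro ceiling_unique) auto
  have c2: "\<lceil>2 ^ n * \<omega>\<rceil> = j" using w' n j by (intro ceiling_unique) auto
  have "sum f {..<Suc n} = sum f {..<n} + real (d m) / 2 ^ m" by (simp add: f_def n)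
  then have "real_of_int (k - 1) / 2 ^ m = real_of_int (j - 1) / 2 ^ n + real (d m) / 2 ^ m"
    unfolding P n[symmetric] c1 c2 .
  then have "real (d m) = 1" by (simp add: n j field_simps)
  then show ?thesis by (simp add: d_def)
qed

lemma nowhere_dense_avoiding:
  assumes A: "infinite A"
  shows "nowhere_dense_in (top_of_set {0<..1})
    {\<omega> \<in> {0<..1::real}. \<forall>n>N. n \<in> A \<longrightarrow> dyadic_digit \<omega> n \<noteq> 1}"
    (is "nowhere_dense_in ?T ?S")
  unfolding nowhere_dense_in_def
proof
  show "?S \<subseteq> topspace ?T" by auto
  show "?T interior_of (?T closure_of ?S) = {}"
  proof (rule ccontr)
    assume "?T interior_of (?T closure_of ?S) \<noteq> {}"
    then obtain b where b: "b \<in> ?T interior_of (?T closure_of ?S)" by blast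
    then obtain O' where O': "open O'" "?T interior_of (?T closure_of ?S) = {0<..1} \<inter> O'"
      using openin_interior_of[of ?T "?T closure_of ?S"] unfolding openin_open by blast
    then obtain e where e: "e > 0" "ball b e \<subseteq> O'"
      using b openE[OF O'(1), of b] by blast
    have b01: "0 < b" "b \<le> 1" using b O' by auto
    define a where "a = max 0 (b - e)"
    have ab: "a < b" using b01 e by (auto simp: a_def)
    have sub: "{a<..<b} \<subseteq> ?T closure_of ?S"
    proof
      fix t assume t: "t \<in> {a<..<b}"
      then have "t \<in> ball b e" by (auto simp: a_def dist_real_def)
      then have "t \<in> {0<..1} \<inter> O'" using e t b01 by (auto simp: a_def)
      then have "t \<in> ?T interior_of (?T closure_of ?S)" using O'(2) by simp
      then show "t \<in> ?T closure_of ?S" by (rule subsetD[OF interior_of_subset])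
    qed
    obtain M where M: "(1/2::real) ^ M < (b - a) / 3"
      using real_arch_pow_inv[of "(b - a) / 3" "1/2"] ab by auto
    obtain m where m: "m > max N M" "m \<in> A"
      using A unfolding infinite_nat_iff_unbounded by blast
    have "(1/2::real) ^ m \<le> (1/2) ^ M"
      using m by (intro power_decreasing) auto
    with M have m3: "3 / 2 ^ m < b - a" by (simp add: power_one_over)
    \<comment> \<open>\<open>k / 2 ^ m\<close> is the last right end point, up to \<open>b\<close>, of a dyadic interval of length \<open>1 / 2 ^ m\<close>
      on which the \<open>m\<close>-th digit is \<open>1\<close>; it misses \<open>b\<close> by less than \<open>2 / 2 ^ m\<close>,
      so that the interval begins less than \<open>3 / 2 ^ m\<close> before \<open>b\<close>.\<close>
    define k where "k = 2 * \<lfloor>2 ^ m * b / 2\<rfloor>"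
    have k: "real_of_int k \<le> 2 ^ m * b" "2 ^ m * b - 3 < real_of_int (k - 1)"
      unfolding k_def by linarith+
    have kb: "real_of_int k / 2 ^ m \<le> b"
      using k(1) by (simp add: pos_divide_le_eq mult.commute)
    have "b - 3 / 2 ^ m = (2 ^ m * b - 3) / 2 ^ m"
      by (simp add: diff_divide_distrib)
    also have "\<dots> < real_of_int (k - 1) / 2 ^ m"
      using k(2) by (rule divide_strict_right_mono) simp
    finally have ka: "b - 3 / 2 ^ m < real_of_int (k - 1) / 2 ^ m" .
    let ?V = "{real_of_int (k - 1) / 2 ^ m<..<real_of_int k / 2 ^ m}"
    have Vsub: "?V \<subseteq> {a<..<b}" using kb ka m3 by auto
    then have V01: "?V \<subseteq> {0<..1}" using b01 by (auto simp: a_def)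
    have "real_of_int (k - 1) / 2 ^ m < real_of_int k / 2 ^ m"
      by (intro divide_strict_right_mono) auto
    then obtain t where t: "t \<in> ?V" using dense by (meson greaterThanLessThan_iff)
    have "openin ?T ?V"
      using V01 by (meson open_greaterThanLessThan open_subset)
    then obtain s where s: "s \<in> ?S" "s \<in> ?V"
      using t Vsub sub unfolding in_closure_of[of _ ?T ?S] subset_iff by blast
    then have "dyadic_digit s m = 1"
      using m by (intro dyadic_digit_eq_1[of s k m]) (auto simp: k_def)
    then show False using s m by auto
  qed
qed

text \<open>Meagerness asks for a union equal to the complement of \<open>A\<close>; a cover can be cut down to one
  because subsets of nowhere dense sets are nowhere dense.\<close>

lemma comeager_inI:
  assumes "A \<subseteq> topspace T" "countable I" "\<And>i. i \<in> I \<Longrightarrow> nowhere_dense_in T (B i)"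
    and "topspace T - A \<subseteq> (\<Union>i\<in>I. B i)"
  shows "comeager_in T A"
proof -
  have "nowhere_dense_in T (B i - A)" if "i \<in> I" for i
  proof -
    have "T interior_of (T closure_of (B i - A)) \<subseteq> T interior_of (T closure_of (B i))"
      by (intro interior_of_mono closure_of_mono) auto
    then show ?thesis using assms(3)[OF that] unfolding nowhere_dense_in_def by auto
  qed
  moreover have "topspace T - A = (\<Union>i\<in>I. B i - A)"
    using assms(3,4) unfolding nowhere_dense_in_def by blast
  ultimately show ?thesis
    unfolding comeager_in_def meager_in_def using assms(1,2)
    by (intro conjI exI[of _ "(\<lambda>i. B i - A) ` I"]) auto
qed

section \<open>Preservation of limit points\<close>

theorem corollary2p2:
  fixes X :: "'a topology" and x :: "nat \<Rightarrow> 'a"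
  assumes "first_countable X"
    and "\<And>F. closedin X F \<Longrightarrow> separable_space (subtopology X F)"
    and "\<And>n. n \<ge> 1 \<Longrightarrow> x n \<in> topspace X"
  shows "comeager_in (top_of_set {0<..1::real})
           {\<omega> \<in> {0<..1}. limit_points X (x \<restriction>\<^sub>d \<omega>) = limit_points X x}"
proof -
  note cluster = limit_points_eq_cluster[OF assms(1)]
  define L where "L = limit_points X x"
  have LX: "L \<subseteq> topspace X" by (auto simp: L_def limit_points_def)
  have "separable_space (subtopology X L)"
    unfolding L_def by (intro assms(2) closedin_limit_points assms(1))
  then obtain D where cD: "countable D" and DL: "D \<subseteq> L"
    and dense: "subtopology X L closure_of D = topspace (subtopology X L)"
    using LX unfolding separable_space_def by auto
  have LD: "L \<subseteq> X closure_of D"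
    using dense DL LX by (auto simp: closure_of_subtopology Int_absorb1)
  have "\<forall>l\<in>D. \<exists>\<B>. countable \<B> \<and> (\<forall>V\<in>\<B>. openin X V) \<and>
      (\<forall>U. openin X U \<and> l \<in> U \<longrightarrow> (\<exists>V\<in>\<B>. l \<in> V \<and> V \<subseteq> U))"
    using assms(1) DL LX unfolding first_countable_def by blast
  then obtain \<B> where cB: "\<And>l. l \<in> D \<Longrightarrow> countable (\<B> l)"
    and oB: "\<And>l V. l \<in> D \<Longrightarrow> V \<in> \<B> l \<Longrightarrow> openin X V"
    and bB: "\<And>l U. l \<in> D \<Longrightarrow> openin X U \<Longrightarrow> l \<in> U \<Longrightarrow> \<exists>V\<in>\<B> l. l \<in> V \<and> V \<subseteq> U"
    by metis
  define \<V> where "\<V> = (\<Union>l\<in>D. {V \<in> \<B> l. l \<in> V})"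
  have cV: "countable \<V>" unfolding \<V>_def using cD cB by auto
  define Bad where
    "Bad = (\<lambda>(V, N). {\<omega> \<in> {0<..1::real}. \<forall>n>N. n \<in> {n. 1 \<le> n \<and> x n \<in> V} \<longrightarrow> dyadic_digit \<omega> n \<noteq> 1})"
  show ?thesis
  proof (rule comeager_inI[where I = "\<V> \<times> UNIV" and B = Bad])
    show "countable (\<V> \<times> (UNIV :: nat set))" using cV by simp
    show "nowhere_dense_in (top_of_set {0<..1}) (Bad i)" if i: "i \<in> \<V> \<times> UNIV" for i
    proof -
      obtain V N where VN: "i = (V, N)" "V \<in> \<V>" using i by auto
      then obtain l where "l \<in> D" "V \<in> \<B> l" "l \<in> V" unfolding \<V>_def by blast
      then have "infinite {n. 1 \<le> n \<and> x n \<in> V}"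
        using oB DL unfolding L_def cluster by blast
      then show ?thesis unfolding VN Bad_def prod.case by (rule nowhere_dense_avoiding)
    qed
    show "topspace (top_of_set {0<..1}) -
        {\<omega> \<in> {0<..1}. limit_points X (x \<restriction>\<^sub>d \<omega>) = limit_points X x} \<subseteq> (\<Union>i\<in>\<V> \<times> UNIV. Bad i)"
    proof (rule ccontr)
      assume "\<not> ?thesis"
      then obtain \<omega> where w: "\<omega> \<in> {0<..1}"
        and ne: "limit_points X (x \<restriction>\<^sub>d \<omega>) \<noteq> L"
        and good: "\<And>V N. V \<in> \<V> \<Longrightarrow> \<omega> \<notin> Bad (V, N)"
        unfolding L_def by fastforce
      have "limit_points X (x \<restriction>\<^sub>d \<omega>) \<subseteq> L"
      proof
        fix l assume l: "l \<in> limit_points X (x \<restriction>\<^sub>d \<omega>)"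
        have "infinite {n. 1 \<le> n \<and> x n \<in> U}" if "openin X U" "l \<in> U" for U
        proof -
          have "infinite {n. 1 \<le> n \<and> dyadic_digit \<omega> n = 1 \<and> x n \<in> U}"
            using l that unfolding cluster infinite_visits_subseq_at_iff[OF w] by blast
          then show ?thesis by (rule contrapos_nn) (erule rev_finite_subset, auto)
        qed
        then show "l \<in> L" using l unfolding L_def cluster by blast
      qed
      moreover have "D \<subseteq> limit_points X (x \<restriction>\<^sub>d \<omega>)"
      proof
        fix l assume l: "l \<in> D"
        have "infinite {n. 1 \<le> n \<and> dyadic_digit \<omega> n = 1 \<and> x n \<in> U}"
          if U: "openin X U" "l \<in> U" for U
          unfolding infinite_nat_iff_unbounded
        proof
          fix N
          obtain V where V: "V \<in> \<B> l" "l \<in> V" "V \<subseteq> U" using bB[OF l U] by blast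
          then have "\<omega> \<notin> Bad (V, N)" using good l unfolding \<V>_def by blast
          then show "\<exists>n>N. n \<in> {n. 1 \<le> n \<and> dyadic_digit \<omega> n = 1 \<and> x n \<in> U}"
            using w V unfolding Bad_def by auto
        qed
        then show "l \<in> limit_points X (x \<restriction>\<^sub>d \<omega>)"
          using l DL LX unfolding cluster infinite_visits_subseq_at_iff[OF w] by blast
      qed
      then have "L \<subseteq> limit_points X (x \<restriction>\<^sub>d \<omega>)"
        using LD closure_of_minimal closedin_limit_points[OF assms(1)] by (metis order_trans)
      ultimately show False using ne by blast
    qed
  qed auto
qed

end
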